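(* Let $m\ge1$, let $A$ (dividend) be an integer with $0\le A\le 10^m-1$ and $B$ (divisor) an integer with $1\le B\le 10^m-1$. Suppose that the TP division procedure, carried out on a yupana with $m$ rows with dividend $A$ and divisor $B$ (with any choices of table movements at the steps where choices are made), reaches its end with subtraction counter $q$ and final current dividend $R$. Then $q$ is the quotient and $R$ is the remainder of the division of $A$ by $B$, i.e. $A=qB+R$ with $0\le R<B$; moreover, if the tokens of the final current dividend are simplified by any finite sequence of table movements ending in a simple state, the number shown is this remainder $R$.
   Context: **Board and states.** A yupana with $m$ rows is the board whose set of squares is $C=\{5,3,2,1\}\times\{0,1,\dots,m-1\}$; the square $(b,r)$ has weight $b$ and lies in row $r$. There are two colors of tokens, positive and negative. A state assigns to each square $(b,r)$ a number $N^+_{b,r}\in\mathbb{Z}_{\ge 0}$ of positive tokens and a number $N^-_{b,r}\in\mathbb{Z}_{\ge 0}$ of negative tokens. The effective value of a positive token on $(b,r)$ is $b\,10^r$ and that of a negative token is $-b\,10^r$; the value of the yupana is the sum of the effective values of all its tokens. **Representation of digits.** A decimal digit is represented in a row by placing one token on each of the following squares of that row (listed by weight) and none on the others: $0$: none; $1$: $\{1\}$; $2$: $\{2\}$; $3$: $\{3\}$; $4$: $\{3,1\}$; $5$: $\{5\}$; $6$: $\{5,1\}$; $7$: $\{5,2\}$; $8$: $\{5,3\}$; $9$: $\{5,3,1\}$. **Loading.** Loading a number $a$ with $0\le a\le 10^m-1$ and decimal digits $d_{m-1}\cdots d_1d_0$, with tokens of a given color, means adding to the current state, for each $r$, tokens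 of that color representing the digit $d_r$ in row $r$. **Simple state.** A configuration of tokens of a single color is simple if each row $r$ represents some digit $d_r\in\{0,\dots,9\}$, meaning that row $r$ has exactly one token of the configuration on each square whose weight belongs to the set $S(d_r)$ and none on its other squares, where $S(0)=\emptyset$, $S(1)=\{1\}$, $S(2)=\{2\}$, $S(3)=\{3\}$, $S(4)=\{3,1\}$, $S(5)=\{5\}$, $S(6)=\{5,1\}$, $S(7)=\{5,2\}$, $S(8)=\{5,3\}$, $S(9)=\{5,3,1\}$; for positive tokens the number shown is $\sum_r d_r10^r$. **TP division procedure.** Load $A$ with positive tokens and $B$ with negative tokens. At each moment the current dividend is the total effective value of the positive tokens, and the displaced divisor with displacement $k$ is the configuration of the negative tokens of $B$ all moved up $k$ rows in their own columns; its absolute value is $B\cdot 10^k$. 1. Set $q\leftarrow 0$. Let $k\ge 0$ be the largest integer such that $B\cdot10^k$ is at most the current dividend $A$, and displace the divisor up by $k$ rows. (If $A<B$, no displacement is made and the procedure ends at once.) 2. Subtraction: execute table movements on the positive tokens until every negative token of the displaced divisor is matched with its own positive token on the same square; then remove these matched positive tokens (one for each negative token), leaving the negative tokens on the board; set $q\leftarrow q+10^k$. 3. If the current dividend is at least $B\cdot 10^k$, go to step 2. Otherwise move the displaced divisor down, one row at a time, setting $k\leftarrow k-1$ each time, until $B\cdot10^k$ is at most the current dividend, and go to step 2. If the divisor can no longer be moved down (i.e. $k=0$ and the current dividend is less than $B$), the procedure ends. **Table movements.** Each movement below is available for every integer $k\ge1$ and row $r$ for which the tokens to be removed are present and all squares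 mentioned exist; here they are applied to positive tokens. (The table also contains a movement removing $k$ positive and $k$ negative tokens from one square; it is not used in this procedure.) Write $c\,[b]_r$ for $c$ tokens on square $(b,r)$; $X\to Y$ means remove $X$ and place $Y$. - Reducing: $2k[2]_r\to k[1]_r+k[3]_r$ (Iskay); $2k[3]_r\to k[1]_r+k[5]_r$ (Kimsa); $2k[5]_r\to k[1]_{r+1}$ (Pisqa); $2k[1]_r\to k[2]_r$, $3k[1]_r\to k[3]_r$, $5k[1]_r\to k[5]_r$ (Kikin); $k[1]_r+k[2]_r\to k[3]_r$, $k[2]_r+k[3]_r\to k[5]_r$ (Pichana). - Expansion: $k[5]_r\to k[3]_r+k[2]_r$; $k[3]_r\to k[2]_r+k[1]_r$; $k[2]_r\to 2k[1]_r$; $k[1]_{r+1}\to 2k[5]_r$; $k[1]_{r+1}\to k[5]_r+k[3]_r+k[2]_r$; $k[1]_{r+1}\to 2k[3]_r+2k[2]_r$; $k[1]_{r+1}\to k[3]_r+2k[2]_r+3k[1]_r$. - Composite: for $b\in\{5,3,2,1\}$ and $n\ge1$, $10^n[b]_r\to 1[b]_{r+n}$ (Chunka, etc.); $2k[2]_r+2k[3]_r\to k[1]_{r+1}$ (Sonqo); $k[5]_r+k[3]_r+k[2]_r\to k[1]_{r+1}$ (Hatun Pichana); $2k[3]_r+k[2]_r+2k[1]_r\to k[1]_{r+1}$ (Paña Chaska); $k[3]_r+2k[2]_r+3k[1]_r\to k[1]_{r+1}$ (Huq-Iskay-Kimsa); $3k[3]_r+k[1]_r\to k[1]_{r+1}$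 (K'usillu). *)

theory Defs
  imports Main "HOL-Library.Multiset"
begin

text \<open>A square is a pair (weight, row); the tokens of one color lying on the board form a
  multiset of squares, so that \<open>count M (b, r)\<close> is the number of tokens on \<open>(b, r)\<close>.\<close>

type_synonym square = "nat \<times> nat"
type_synonym config = "square multiset"

datatype color = Positive | Negative

type_synonym state = "color \<Rightarrow> config"

definition weights :: "nat set" where
  "weights = {5, 3, 2, 1}"

definition board :: "nat \<Rightarrow> square set" where
  "board m = weights \<times> {0..<m}"

definition empty_board :: state where
  "empty_board = (\<lambda>_. {#})"

fun effective_value :: "color \<Rightarrow> square \<Rightarrow> int" where
  "effective_value Positive (b, r) = int b * 10 ^ r"
| "effective_value Negative (b, r) = - (int b * 10 ^ r)"

definition current_dividend :: "state \<Rightarrow> int" where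
  "current_dividend s = (\<Sum>x\<in>#s Positive. effective_value Positive x)"

text \<open>Only meaningful for arguments up to 9.\<close>

definition digit_weights :: "nat \<Rightarrow> nat set" where
  "digit_weights d =
     [{}, {1}, {2}, {3}, {3, 1}, {5}, {5, 1}, {5, 2}, {5, 3}, {5, 3, 1}] ! d"

definition decimal_digit :: "int \<Rightarrow> nat \<Rightarrow> nat" where
  "decimal_digit a r = nat ((a div 10 ^ r) mod 10)"

definition number_tokens :: "nat \<Rightarrow> int \<Rightarrow> config" where
  "number_tokens m a = (\<Sum>r<m. mset_set (digit_weights (decimal_digit a r) \<times> {r}))"

definition load :: "nat \<Rightarrow> color \<Rightarrow> int \<Rightarrow> state \<Rightarrow> state" where
  "load m c a s = s(c := s c + number_tokens m a)"

definition row_shows :: "config \<Rightarrow> nat \<Rightarrow> nat \<Rightarrow> bool" where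
  "row_shows M r d \<longleftrightarrow>
     d \<le> 9 \<and> (\<forall>b\<in>weights. count M (b, r) = (if b \<in> digit_weights d then 1 else 0))"

definition simple :: "nat \<Rightarrow> config \<Rightarrow> bool" where
  "simple m M \<longleftrightarrow> (\<forall>r<m. \<exists>d. row_shows M r d)"

text \<open>Only meaningful for simple configurations, where the digit shown by each row is unique.\<close>

definition number_shown :: "nat \<Rightarrow> config \<Rightarrow> int" where
  "number_shown m M = (\<Sum>r<m. int (THE d. row_shows M r d) * 10 ^ r)"

abbreviation tokens :: "nat \<Rightarrow> nat \<Rightarrow> nat \<Rightarrow> config" where
  "tokens c b r \<equiv> replicate_mset c (b, r)"

text \<open>\<open>table_rule X Y\<close>: the table of movements contains the movement removing \<open>X\<close> and placing \<open>Y\<close>.\<close>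

inductive table_rule :: "config \<Rightarrow> config \<Rightarrow> bool" where
  iskay:
    "k \<ge> 1 \<Longrightarrow> table_rule (tokens (2 * k) 2 r) (tokens k 1 r + tokens k 3 r)"
| kimsa:
    "k \<ge> 1 \<Longrightarrow> table_rule (tokens (2 * k) 3 r) (tokens k 1 r + tokens k 5 r)"
| pisqa:
    "k \<ge> 1 \<Longrightarrow> table_rule (tokens (2 * k) 5 r) (tokens k 1 (r + 1))"
| kikin_2:
    "k \<ge> 1 \<Longrightarrow> table_rule (tokens (2 * k) 1 r) (tokens k 2 r)"
| kikin_3:
    "k \<ge> 1 \<Longrightarrow> table_rule (tokens (3 * k) 1 r) (tokens k 3 r)"
| kikin_5:
    "k \<ge> 1 \<Longrightarrow> table_rule (tokens (5 * k) 1 r) (tokens k 5 r)"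
| pichana_3:
    "k \<ge> 1 \<Longrightarrow> table_rule (tokens k 1 r + tokens k 2 r) (tokens k 3 r)"
| pichana_5:
    "k \<ge> 1 \<Longrightarrow> table_rule (tokens k 2 r + tokens k 3 r) (tokens k 5 r)"
| expand_5:
    "k \<ge> 1 \<Longrightarrow> table_rule (tokens k 5 r) (tokens k 3 r + tokens k 2 r)"
| expand_3:
    "k \<ge> 1 \<Longrightarrow> table_rule (tokens k 3 r) (tokens k 2 r + tokens k 1 r)"
| expand_2:
    "k \<ge> 1 \<Longrightarrow> table_rule (tokens k 2 r) (tokens (2 * k) 1 r)"
| expand_10_55:
    "k \<ge> 1 \<Longrightarrow> table_rule (tokens k 1 (r + 1)) (tokens (2 * k) 5 r)"
| expand_10_532:
    "k \<ge> 1 \<Longrightarrow> table_rule (tokens k 1 (r + 1)) (tokens k 5 r + tokens k 3 r + tokens k 2 r)"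
| expand_10_3322:
    "k \<ge> 1 \<Longrightarrow> table_rule (tokens k 1 (r + 1)) (tokens (2 * k) 3 r + tokens (2 * k) 2 r)"
| expand_10_322111:
    "k \<ge> 1 \<Longrightarrow> table_rule (tokens k 1 (r + 1))
       (tokens k 3 r + tokens (2 * k) 2 r + tokens (3 * k) 1 r)"
| chunka:
    "b \<in> weights \<Longrightarrow> n \<ge> 1 \<Longrightarrow> table_rule (tokens (10 ^ n) b r) (tokens 1 b (r + n))"
| sonqo:
    "k \<ge> 1 \<Longrightarrow> table_rule (tokens (2 * k) 2 r + tokens (2 * k) 3 r) (tokens k 1 (r + 1))"
| hatun_pichana:
    "k \<ge> 1 \<Longrightarrow> table_rule (tokens k 5 r + tokens k 3 r + tokens k 2 r) (tokens k 1 (r + 1))"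
| pana_chaska:
    "k \<ge> 1 \<Longrightarrow> table_rule (tokens (2 * k) 3 r + tokens k 2 r + tokens (2 * k) 1 r)
       (tokens k 1 (r + 1))"
| huq_iskay_kimsa:
    "k \<ge> 1 \<Longrightarrow> table_rule (tokens k 3 r + tokens (2 * k) 2 r + tokens (3 * k) 1 r)
       (tokens k 1 (r + 1))"
| kusillu:
    "k \<ge> 1 \<Longrightarrow> table_rule (tokens (3 * k) 3 r + tokens k 1 r) (tokens k 1 (r + 1))"

definition table_move :: "nat \<Rightarrow> config \<Rightarrow> config \<Rightarrow> bool" where
  "table_move m M M' \<longleftrightarrow>
     (\<exists>X Y. table_rule X Y \<and> set_mset X \<subseteq> board m \<and> set_mset Y \<subseteq> board m \<and>
            X \<subseteq># M \<and> M' = M - X + Y)"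

definition displaced_divisor :: "nat \<Rightarrow> int \<Rightarrow> nat \<Rightarrow> config" where
  "displaced_divisor m B k = image_mset (\<lambda>(b, r). (b, r + k)) (number_tokens m B)"

text \<open>Each negative token has its own positive token on the same square.\<close>

definition all_matched :: "state \<Rightarrow> bool" where
  "all_matched s \<longleftrightarrow> s Negative \<subseteq># s Positive"

text \<open>The procedure as a nondeterministic transition system.  A situation consists of the step
  about to be executed, the state of the board and, from step 2 on, the displacement \<open>k\<close> and the
  counter \<open>q\<close>.\<close>

datatype situation =
    Step1 state
  | Step2 state nat int
  | Step3 state nat int
  | Ended state int

inductive tp_step :: "nat \<Rightarrow> int \<Rightarrow> situation \<Rightarrow> situation \<Rightarrow> bool" for m :: nat and B :: int where
  too_small:
    "current_dividend s < B \<Longrightarrow> tp_step m B (Step1 s) (Ended s 0)"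
| displace:
    "B \<le> current_dividend s \<Longrightarrow>
     k = (GREATEST k. B * 10 ^ k \<le> current_dividend s) \<Longrightarrow>
     tp_step m B (Step1 s) (Step2 (s(Negative := displaced_divisor m B k)) k 0)"
| rearrange:
    "\<not> all_matched s \<Longrightarrow> table_move m (s Positive) P \<Longrightarrow>
     tp_step m B (Step2 s k q) (Step2 (s(Positive := P)) k q)"
| subtract:
    "all_matched s \<Longrightarrow>
     tp_step m B (Step2 s k q)
       (Step3 (s(Positive := s Positive - s Negative)) k (q + 10 ^ k))"
| again:
    "B * 10 ^ k \<le> current_dividend s \<Longrightarrow> tp_step m B (Step3 s k q) (Step2 s k q)"
| move_down:
    "current_dividend s < B * 10 ^ Suc k \<Longrightarrow>
     tp_step m B (Step3 s (Suc k) q) (Step3 (s(Negative := displaced_divisor m B k)) k q)"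
| finish:
    "current_dividend s < B * 10 ^ 0 \<Longrightarrow> tp_step m B (Step3 s 0 q) (Ended s q)"

definition tp_division_ends :: "nat \<Rightarrow> int \<Rightarrow> int \<Rightarrow> state \<Rightarrow> int \<Rightarrow> bool" where
  "tp_division_ends m A B s q \<longleftrightarrow>
     (tp_step m B)\<^sup>*\<^sup>* (Step1 (load m Negative B (load m Positive A empty_board))) (Ended s q)"

end

theory Submission
  imports Defs
begin

text \<open>Every table movement preserves the total value of the positive tokens, and each execution of
  step 2 lowers it by \<open>B * 10 ^ k\<close> while raising \<open>q\<close> by \<open>10 ^ k\<close>. Hence the dividend plus \<open>q * B\<close> is
  an invariant equal to \<open>A\<close>, and the stopping condition forces the final dividend below \<open>B\<close>.\<close>

text \<open>Defined on a single configuration rather than on a state, so that it also measures the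
  divisor: applied to its negative tokens it gives the absolute value.\<close>

definition config_value :: "config \<Rightarrow> int" where
  "config_value M = (\<Sum>x\<in>#M. effective_value Positive x)"

lemma current_dividend_eq: "current_dividend s = config_value (s Positive)"
  by (simp add: current_dividend_def config_value_def)

lemma config_value_empty [simp]: "config_value {#} = 0"
  by (simp add: config_value_def)

lemma config_value_union [simp]: "config_value (M + N) = config_value M + config_value N"
  by (simp add: config_value_def)

lemma config_value_tokens [simp]: "config_value (tokens c b r) = int c * (int b * 10 ^ r)"
  by (simp add: config_value_def)

lemma config_value_single [simp]: "config_value {#(b, r)#} = int b * 10 ^ r"
  by (simp add: config_value_def)

lemma config_value_diff: "N \<subseteq># M \<Longrightarrow> config_value (M - N) = config_value M - config_value N"
  by (metis add_diff_cancel_right' config_value_union subset_mset.diff_add)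

lemma config_value_nonneg: "0 \<le> config_value M"
proof (induction M)
  case (add x M)
  then show ?case by (cases x) (simp add: config_value_def)
qed simp

lemma config_value_sum: "config_value (\<Sum>i\<in>I. F i) = (\<Sum>i\<in>I. config_value (F i))"
  by (induction I rule: infinite_finite_induct) simp_all

lemma config_value_displace:
  "config_value (image_mset (\<lambda>(b, r). (b, r + k)) M) = config_value M * 10 ^ k"
proof (induction M)
  case (add x M)
  then show ?case by (cases x) (simp add: config_value_def power_add algebra_simps)
qed simp

text \<open>Each entry of the table is a multiple of an identity such as 2 + 3 = 5 or 2 * 5 = 10, a
  step up one row being worth a factor 10; for \<open>chunka\<close> it is the factor
  \<open>10 ^ n\<close>.\<close>

lemma table_rule_value: "table_rule X Y \<Longrightarrow> config_value X = config_value Y"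
  by (induction rule: table_rule.induct) (simp_all add: power_add)

lemma table_move_value: "table_move m M M' \<Longrightarrow> config_value M' = config_value M"
proof -
  assume "table_move m M M'"
  then obtain X Y where "table_rule X Y" "X \<subseteq># M" "M' = M - X + Y"
    by (auto simp only: table_move_def)
  then show "config_value M' = config_value M"
    by (simp only: config_value_diff config_value_union table_rule_value[of X Y])
qed

text \<open>Removal only shrinks the support, and a movement places tokens on existing squares only.
  Staying on the board matters because \<open>number_shown\<close> sees only rows below
  \<open>m\<close>.\<close>

lemma table_move_board:
  "table_move m M M' \<Longrightarrow> set_mset M \<subseteq> board m \<Longrightarrow> set_mset M' \<subseteq> board m"
proof -
  assume "table_move m M M'" and M: "set_mset M \<subseteq> board m"
  then obtain X Y where Y: "set_mset Y \<subseteq> board m" and M': "M' = M - X + Y"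
    by (auto simp only: table_move_def)
  show "set_mset M' \<subseteq> board m"
    using M Y unfolding M' set_mset_union by (blast dest: in_diffD)
qed

lemma table_moves_invariant:
  assumes "(table_move m)\<^sup>*\<^sup>* M M'" and "set_mset M \<subseteq> board m"
  shows "config_value M' = config_value M \<and> set_mset M' \<subseteq> board m"
  using assms by (induction rule: rtranclp_induct) (auto simp: table_move_value dest: table_move_board)

text \<open>\<open>digit_weights\<close> looks up an entry of a ten-element list, so its properties
  are checked entry by entry.\<close>

lemma digit_cases:
  fixes d :: nat
  assumes "d \<le> 9"
  obtains "d = 0" | "d = 1" | "d = 2" | "d = 3" | "d = 4"
    | "d = 5" | "d = 6" | "d = 7" | "d = 8" | "d = 9"
proof -
  have "d = 0 \<or> d = 1 \<or> d = 2 \<or> d = 3 \<or> d = 4 \<or> d = 5 \<or> d = 6 \<or> d = 7 \<or> d = 8 \<or> d = 9"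
    using assms by presburger
  then show thesis using that by blast
qed

lemma digit_weights_subset: "d \<le> 9 \<Longrightarrow> digit_weights d \<subseteq> weights"
  by (erule digit_cases) (auto simp: digit_weights_def weights_def)

lemma finite_digit_weights: "d \<le> 9 \<Longrightarrow> finite (digit_weights d)"
  using digit_weights_subset by (rule finite_subset) (simp_all add: weights_def)

lemma sum_digit_weights: "d \<le> 9 \<Longrightarrow> \<Sum>(digit_weights d) = d"
  by (erule digit_cases) (simp_all add: digit_weights_def)

text \<open>The digit function is arbitrary so that loaded numbers and simple states are instances
  of the same configuration.\<close>

definition digits_config :: "nat \<Rightarrow> (nat \<Rightarrow> nat) \<Rightarrow> config" where
  "digits_config m d = (\<Sum>r<m. mset_set (digit_weights (d r) \<times> {r}))"

lemma config_value_digits_config: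
  assumes "\<And>r. r < m \<Longrightarrow> d r \<le> 9"
  shows "config_value (digits_config m d) = (\<Sum>r<m. int (d r) * 10 ^ r)"
proof -
  have "config_value (mset_set (digit_weights (d r) \<times> {r})) = int (d r) * 10 ^ r" if "r < m" for r
  proof -
    have "config_value (mset_set (digit_weights (d r) \<times> {r}))
        = (\<Sum>x\<in>digit_weights (d r) \<times> {r}. effective_value Positive x)"
      by (simp add: config_value_def sum_unfold_sum_mset)
    also have "\<dots> = (\<Sum>b\<in>digit_weights (d r). int b * 10 ^ r)"
      by (rule sum.reindex_cong[of "\<lambda>b. (b, r)"]) (auto simp: inj_on_def)
    also have "\<dots> = int (\<Sum>(digit_weights (d r))) * 10 ^ r"
      by (simp add: sum_distrib_right)
    finally show ?thesis
      using sum_digit_weights[OF assms[OF that]] by simp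
  qed
  then show ?thesis
    by (simp add: digits_config_def config_value_sum)
qed

lemma set_digits_config:
  assumes "\<And>r. r < m \<Longrightarrow> d r \<le> 9"
  shows "set_mset (digits_config m d) \<subseteq> board m"
proof -
  have "set_mset (mset_set (digit_weights (d r) \<times> {r})) \<subseteq> board m" if "r < m" for r
    using that digit_weights_subset[OF assms[OF that]] finite_digit_weights[OF assms[OF that]]
    by (auto simp: board_def)
  then show ?thesis
    by (auto simp: digits_config_def set_mset_sum)
qed

lemma count_digits_config:
  assumes "\<And>r. r < m \<Longrightarrow> d r \<le> 9"
  shows "count (digits_config m d) (b, r) = (if r < m \<and> b \<in> digit_weights (d r) then 1 else 0)"
proof -
  have "count (digits_config m d) (b, r)
      = (\<Sum>i<m. if i = r then (if b \<in> digit_weights (d r) then 1 else 0) else 0)"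
    unfolding digits_config_def count_sum
  proof (rule sum.cong)
    fix i assume "i \<in> {..<m}"
    then have "finite (digit_weights (d i) \<times> {i})"
      using assms finite_digit_weights by simp
    then show "count (mset_set (digit_weights (d i) \<times> {i})) (b, r)
        = (if i = r then (if b \<in> digit_weights (d r) then 1 else 0) else 0)"
      by (auto simp: count_mset_set')
  qed simp
  then show ?thesis by simp
qed

text \<open>The induction splits off the leading digit. For 0 \<le> a < \<open>10 ^ m\<close> the
  right-hand side is \<open>a\<close> itself, which gives the value of a loaded number.\<close>

lemma sum_decimal_digits:
  fixes a :: int
  shows "(\<Sum>r<m. (a div 10 ^ r mod 10) * 10 ^ r) = a mod 10 ^ m"
proof (induction m)
  case (Suc m)
  have "a mod 10 ^ Suc m = 10 ^ m * (a div 10 ^ m mod 10) + a mod 10 ^ m"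
    by (simp add: zmod_zmult2_eq mult.commute[of 10])
  with Suc show ?case by simp
qed simp

lemma decimal_digit_le: "decimal_digit a r \<le> 9"
proof -
  have "a div 10 ^ r mod 10 < 10" by simp
  then show ?thesis by (simp add: decimal_digit_def)
qed

lemma number_tokens_eq: "number_tokens m a = digits_config m (decimal_digit a)"
  by (simp add: number_tokens_def digits_config_def)

lemma config_value_number_tokens:
  assumes "0 \<le> a" and "a < 10 ^ m"
  shows "config_value (number_tokens m a) = a"
  using assms sum_decimal_digits[of a m]
  by (simp add: number_tokens_eq config_value_digits_config decimal_digit_le)
    (simp add: decimal_digit_def)

lemma set_number_tokens: "set_mset (number_tokens m a) \<subseteq> board m"
  by (simp add: number_tokens_eq set_digits_config decimal_digit_le)

text \<open>The counts in the row determine the set of occupied weights, and a digit is the sum of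
  its weights. This makes the \<open>THE\<close> in \<open>number_shown\<close> well
  defined.\<close>

lemma row_shows_unique:
  assumes "row_shows M r d" and "row_shows M r e"
  shows "d = e"
proof -
  have "digit_weights d = {b \<in> weights. count M (b, r) = 1}" if "row_shows M r d" for d
  proof -
    have "count M (b, r) = 1 \<longleftrightarrow> b \<in> digit_weights d" if "b \<in> weights" for b
      using \<open>row_shows M r d\<close> that by (simp add: row_shows_def)
    moreover have "digit_weights d \<subseteq> weights"
      using that digit_weights_subset by (simp add: row_shows_def)
    ultimately show ?thesis by blast
  qed
  with assms have "digit_weights d = digit_weights e" by simp
  moreover have "d \<le> 9" "e \<le> 9" using assms by (simp_all add: row_shows_def)
  ultimately show ?thesis by (metis sum_digit_weights)
qed

text \<open>A simple configuration confined to the board is exactly the \<open>digits_config\<close>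
  of the digits it shows, since \<open>simple\<close> fixes every count on the board and confinement
  makes all others zero.\<close>

lemma number_shown_simple:
  assumes "simple m M" and "set_mset M \<subseteq> board m"
  shows "number_shown m M = config_value M"
proof -
  define d where "d r = (THE d. row_shows M r d)" for r
  have shows_d: "row_shows M r (d r)" if "r < m" for r
    using assms(1) that row_shows_unique unfolding simple_def d_def by (metis theI)
  then have le: "d r \<le> 9" if "r < m" for r
    using that by (simp add: row_shows_def)
  have "M = digits_config m d"
  proof (rule multiset_eqI)
    fix x :: square
    obtain b r where x: "x = (b, r)" by (cases x)
    show "count M x = count (digits_config m d) x"
    proof (cases "x \<in> board m")
      case True
      then show ?thesis
        using shows_d[of r] by (simp add: x board_def row_shows_def count_digits_config le)
    next
      case False
      then show ?thesis
        using assms(2) set_digits_config[of m d, OF le] by (metis not_in_iff subsetD)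
    qed
  qed
  moreover have "number_shown m M = (\<Sum>r<m. int (d r) * 10 ^ r)"
    by (simp add: number_shown_def d_def)
  ultimately show ?thesis
    by (simp only: config_value_digits_config le)
qed

text \<open>The argument \<open>x\<close> stands for the total amount subtracted so far.\<close>

definition balanced :: "nat \<Rightarrow> int \<Rightarrow> state \<Rightarrow> int \<Rightarrow> bool" where
  "balanced m A s x \<longleftrightarrow> set_mset (s Positive) \<subseteq> board m \<and> current_dividend s + x = A"

text \<open>The negative tokens are tracked from step 2 on, so that the amount removed by a
  subtraction is known. The bound below \<open>B\<close> appears only at the end, where the guard of
  \<open>too_small\<close> or \<open>finish\<close> supplies it.\<close>

fun tp_invariant :: "nat \<Rightarrow> int \<Rightarrow> int \<Rightarrow> situation \<Rightarrow> bool" where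
  "tp_invariant m A B (Step1 s) \<longleftrightarrow> balanced m A s 0"
| "tp_invariant m A B (Step2 s k q) \<longleftrightarrow>
     balanced m A s (q * B) \<and> s Negative = displaced_divisor m B k"
| "tp_invariant m A B (Step3 s k q) \<longleftrightarrow>
     balanced m A s (q * B) \<and> s Negative = displaced_divisor m B k"
| "tp_invariant m A B (Ended s q) \<longleftrightarrow> balanced m A s (q * B) \<and> current_dividend s < B"

lemma tp_step_invariant:
  assumes "tp_step m B S S'" and "tp_invariant m A B S" and "0 \<le> B" and "B < 10 ^ m"
  shows "tp_invariant m A B S'"
  using assms(1,2)
proof cases
  case (rearrange s P k q)
  then show ?thesis
    using assms(2)
    by (auto simp: balanced_def current_dividend_eq table_move_value dest: table_move_board)
next
  case (subtract s k q)
  \<comment> \<open>As \<open>B < 10 ^ m\<close>, the \<open>m\<close> loaded digits represent all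
    of \<open>B\<close>. Matching makes the multiset difference exact, so this value passes from the
    dividend to \<open>q * B\<close>.\<close>
  have "config_value (displaced_divisor m B k) = B * 10 ^ k"
    using assms(3,4)
    by (simp add: displaced_divisor_def config_value_displace config_value_number_tokens)
  then show ?thesis
    using assms(2) subtract
    by (auto simp: balanced_def current_dividend_eq all_matched_def config_value_diff algebra_simps
        dest: in_diffD)
\<comment> \<open>The remaining steps leave the positive tokens alone and either keep
  \<open>q\<close> or start it at 0.\<close>
qed (use assms(2) in \<open>auto simp: balanced_def current_dividend_eq\<close>)

theorem theorem9:
  fixes m :: nat and A B q R :: int and s :: state
  assumes "m \<ge> 1"
    and "0 \<le> A" and "A \<le> 10 ^ m - 1"
    and "1 \<le> B" and "B \<le> 10 ^ m - 1"
    and "tp_division_ends m A B s q"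
    and "R = current_dividend s"
  shows "q = A div B \<and> R = A mod B \<and> A = q * B + R \<and> 0 \<le> R \<and> R < B \<and>
    (\<forall>M. (table_move m)\<^sup>*\<^sup>* (s Positive) M \<and> simple m M \<longrightarrow> number_shown m M = R)"
proof -
  let ?start = "Step1 (load m Negative B (load m Positive A empty_board))"
  have "(tp_step m B)\<^sup>*\<^sup>* ?start (Ended s q)"
    using assms(6) by (simp add: tp_division_ends_def)
  moreover have "tp_invariant m A B ?start"
    using assms(2,3) set_number_tokens[of m A]
    by (simp add: balanced_def load_def empty_board_def current_dividend_eq
        config_value_number_tokens)
  ultimately have "tp_invariant m A B (Ended s q)"
  proof (induction rule: rtranclp_induct)
    case (step S S')
    then show ?case
      using tp_step_invariant[of m B S S' A] assms(4,5) by simp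
  qed
  then have board: "set_mset (s Positive) \<subseteq> board m" and eq: "A = q * B + R" and less: "R < B"
    using assms(7) by (auto simp: balanced_def)
  have nonneg: "0 \<le> R"
    by (simp add: assms(7) current_dividend_eq config_value_nonneg)
  \<comment> \<open>Uniqueness of Euclidean division.\<close>
  have "q = A div B" "R = A mod B"
    using eq nonneg less by simp_all
  \<comment> \<open>Simplification keeps both the value \<open>R\<close> and the confinement to the
    board, so the simple state reached shows its value.\<close>
  moreover have "number_shown m M = R" if "(table_move m)\<^sup>*\<^sup>* (s Positive) M" "simple m M" for M
    using table_moves_invariant[OF that(1) board] number_shown_simple[OF that(2)] assms(7)
    by (simp add: current_dividend_eq)
  ultimately show ?thesis
    using eq nonneg less by blast
qed

end
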